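(* Let $H$ be a hypergraph and let $(P^T,[0,1]^{V(H)})$ be a random walk on $H$ with probability transition matrix $P$, where $P^T$ is a star-dependent matrix. For any unit $W_E\in\mathfrak{U}(H)$, the random walk is forward invariant in the subspace $C_{W_E}$; that is, for every state $x\in[0,1]^{V(H)}$ with $x\in C_{W_E}$, one has $P^Tx\in C_{W_E}$.
   Context: A hypergraph $H=(V(H),E(H))$ consists of a finite nonempty vertex set $V(H)$ and a finite family $E(H)$ of nonempty subsets of $V(H)$, called hyperedges. The star of a vertex $i$ is $E_i(H)=\{e\in E(H): i\in e\}$, and $\mathfrak{E}(H)=\{E_i(H): i\in V(H)\}$ is the set of all stars. A real matrix $(m_{ij})_{i,j\in V(H)}$ is star-dependent if there exist functions $g:\mathfrak{E}(H)\times\mathfrak{E}(H)\to\mathbb{R}$ and $h:\mathfrak{E}(H)\to\mathbb{R}$ such that $m_{ij}=g(E_i(H),E_j(H))$ if $i\neq j$ and $m_{ii}=h(E_i(H))$. The units of $H$ are the equivalence classes of the relation $\{(i,j): E_i(H)=E_j(H)\}$ on $V(H)$; $\mathfrak{U}(H)$ is the set of all units. For a star $E$, $W_E=\{i\in V(H): E_i(H)=E\}$ is the unit generated by $E$. For $U\subseteq V(H)$, $C_U=\{x\in\mathbb{R}^{V(H)}: \text{there is } c_x\in\mathbb{R} \text{ with } x(i)=c_x \text{ for all } i\in U\}$. A random walk on $H$ is a (time-homogeneous) Markov chain on $V(H)$ with probability transition matrix $P=(P_{uv})_{u,v\in V(H)}$, where $P_{uv}$ is the transition probability from $u$ to $v$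 (so $P_{uv}\ge 0$ and each row of $P$ sums to $1$). Its state at time $t$ is the probability distribution $x_t:V(H)\to[0,1]$, evolving by $x_{t+1}=P^Tx_t$; it is regarded as the dynamical system $(P^T,[0,1]^{V(H)})$. *)

theory Defs
  imports "HOL-Analysis.Analysis"
begin

(* The vertex set V(H) is the universe of a type 'v of class finite, so that it is finite and
   nonempty and R^V(H) is real ^ 'v; a hypergraph is then given by its set of hyperedges, which is
   automatically a finite set of subsets of V(H). *)
definition hypergraph :: "('v::finite) set set \<Rightarrow> bool" where
  "hypergraph H \<longleftrightarrow> {} \<notin> H"

definition star :: "'v set set \<Rightarrow> 'v \<Rightarrow> 'v set set" where
  "star H i = {e \<in> H. i \<in> e}"

(* The functions g and h are total here; their values outside the set of stars of H are never
   used. *)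
definition star_dependent :: "('v::finite) set set \<Rightarrow> real ^ 'v ^ 'v \<Rightarrow> bool" where
  "star_dependent H M \<longleftrightarrow>
    (\<exists>(g :: 'v set set \<Rightarrow> 'v set set \<Rightarrow> real) (h :: 'v set set \<Rightarrow> real).
       \<forall>i j. M $ i $ j = (if i \<noteq> j then g (star H i) (star H j) else h (star H i)))"

definition hunits :: "'v set set \<Rightarrow> 'v set set" where
  "hunits H = UNIV // {(i, j). star H i = star H j}"

(* The set W_E. It is empty when E is not a star, and then it is not in hunits H. *)
definition generated_unit :: "'v set set \<Rightarrow> 'v set set \<Rightarrow> 'v set" where
  "generated_unit H E = {i. star H i = E}"

definition constant_on_space :: "('v::finite) set \<Rightarrow> (real ^ 'v) set" where
  "constant_on_space U = {x. \<exists>c. \<forall>i\<in>U. x $ i = c}"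

definition transition_matrix :: "real ^ ('v::finite) ^ 'v \<Rightarrow> bool" where
  "transition_matrix P \<longleftrightarrow> (\<forall>u v. 0 \<le> P $ u $ v) \<and> (\<forall>u. (\<Sum>v\<in>UNIV. P $ u $ v) = 1)"

(* The state space [0,1]^V(H); the coordinates are not required to sum to 1, so it contains all
   probability distributions on V(H). *)
definition state_space :: "(real ^ ('v::finite)) set" where
  "state_space = {x. \<forall>i. 0 \<le> x $ i \<and> x $ i \<le> 1}"

definition forward_invariant :: "('a \<Rightarrow> 'a) \<Rightarrow> 'a set \<Rightarrow> 'a set \<Rightarrow> bool" where
  "forward_invariant f X S \<longleftrightarrow> (\<forall>x\<in>X. x \<in> S \<longrightarrow> f x \<in> S)"

end

theory Submission imports Defs begin

text \<open>
  A star-dependent matrix \<open>M\<close> with functions \<open>g\<close> and \<open>h\<close> splits as \<open>M = G + D\<close>. Here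
  \<open>G\<close> has the entries \<open>g(E\<^sub>i, E\<^sub>j)\<close> at all positions, the diagonal included, and \<open>D\<close> is the
  diagonal matrix with entries \<open>h(E\<^sub>i) - g(E\<^sub>i, E\<^sub>i)\<close>. Rows of \<open>G\<close> that belong to the same unit
  are equal, so \<open>G x\<close> is constant on every unit, for every \<open>x\<close>. On a unit, \<open>D\<close> is
  multiplication by a single scalar, so it keeps a vector constant there. Hence \<open>M\<close> maps the
  vectors that are constant on a given unit to vectors of the same kind
  (\<open>star_dependent_mult_constant_on_unit\<close>), and the theorem is the case \<open>M = P\<^sup>T\<close>.
\<close>

text \<open>
  The decomposition \<open>M = G + D\<close>, applied to a vector. The sum runs over all vertices, \<open>i\<close> included,
  so that it depends on \<open>i\<close> only through its star; the last term corrects the diagonal entry.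
\<close>

lemma star_dependent_mult_componentE:
  fixes M :: "real ^ ('v::finite) ^ 'v"
  assumes "star_dependent H M"
  obtains g h where
    "\<And>x i. (M *v x) $ i = (\<Sum>j\<in>UNIV. g (star H i) (star H j) * x $ j)
                       + (h (star H i) - g (star H i) (star H i)) * x $ i"
proof -
  from assms obtain g h where
    M: "\<And>i j. M $ i $ j = (if i \<noteq> j then g (star H i) (star H j) else h (star H i))"
    unfolding star_dependent_def by blast
  have "(M *v x) $ i = (\<Sum>j\<in>UNIV. g (star H i) (star H j) * x $ j)
                       + (h (star H i) - g (star H i) (star H i)) * x $ i" for x i
  proof -
    have "(M *v x) $ i = (\<Sum>j\<in>UNIV. M $ i $ j * x $ j)"
      by (simp add: matrix_vector_mult_def)
    also have "\<dots> = (\<Sum>j\<in>UNIV. g (star H i) (star H j) * x $ j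
                + (if j = i then (h (star H i) - g (star H i) (star H i)) * x $ i else 0))"
      by (rule sum.cong) (auto simp: M algebra_simps)
    finally show ?thesis
      by (simp add: sum.distrib)
  qed
  then show thesis by (rule that)
qed

lemma star_dependent_mult_constant_on_unit:
  assumes "star_dependent H M" and "x \<in> constant_on_space (generated_unit H E)"
  shows "M *v x \<in> constant_on_space (generated_unit H E)"
proof -
  from assms(1) obtain g h where
    Mx: "\<And>x i. (M *v x) $ i = (\<Sum>j\<in>UNIV. g (star H i) (star H j) * x $ j)
                       + (h (star H i) - g (star H i) (star H i)) * x $ i"
    by (rule star_dependent_mult_componentE) blast
  from assms(2) obtain c where c: "\<And>i. star H i = E \<Longrightarrow> x $ i = c"
    by (auto simp: constant_on_space_def generated_unit_def)
  have "(M *v x) $ i = (\<Sum>j\<in>UNIV. g E (star H j) * x $ j) + (h E - g E E) * c"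
    if "star H i = E" for i
    using that by (simp add: Mx c)
  then show ?thesis
    by (auto simp: constant_on_space_def generated_unit_def)
qed

theorem theorem3p1:
  fixes H :: "('v::finite) set set" and P :: "real ^ 'v ^ 'v" and E :: "'v set set"
  assumes "hypergraph H"
    and "transition_matrix P"
    and "star_dependent H (transpose P)"
    and "generated_unit H E \<in> hunits H"
  shows "forward_invariant (\<lambda>x. transpose P *v x) state_space
           (constant_on_space (generated_unit H E))"
  unfolding forward_invariant_def
  using star_dependent_mult_constant_on_unit[OF assms(3)] by blast

end
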